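(* The cylinder $Cyl^p=([0,1]\times S^1,\tau^p)$ is Gromov–Hausdorff continuous in $p$ for all $p\in[1,\infty)$, i.e. for every $p\in[1,\infty)$ one has $d_{GH}^-(Cyl^p,Cyl^q)\to0$ as $q\to p$. For $p\to\infty$ ($p\in\mathbb{N}$), the sequence $\{Cyl^p\}_p$ diverges with respect to $d_{GH}^-$ and is therefore not precompact, although the pointwise limit of $\tau^p$ as $p\to\infty$ exists.
   Context: $S^1=\mathbb{R}/2\pi\mathbb{Z}$, with arc-length distance $\delta(\alpha,\beta)\in[0,\pi]$. $Cyl^p$ is the set $[0,1]\times S^1$ (first coordinate is time) with the time separation function, for $1\le p<\infty$, $$\tau^p((s,\alpha),(t,\beta))=\big((t-s)^p-\delta(\alpha,\beta)^p\big)^{1/p}\ \text{ if } t-s\ge\delta(\alpha,\beta),\qquad \tau^p=0\ \text{ otherwise}.$$ An almost Lorentzian pre-length space is a pair $(X,\tau)$ of a set $X$ and an antisymmetric function $\tau:X\times X\to\mathbb{R}$ with $\tau(x,z)\ge\tau(x,y)+\tau(y,z)$ whenever $\tau(x,y)>0$ and $\tau(y,z)>0$. By convention a non-negative time separation function $\tau$ is identified with its antisymmetric version $\tau^a(x,y)=\tau(x,y)-\tau(y,x)$, and $Cyl^p$ is viewed as an almost Lorentzian pre-length space in this way. The Gromov–Hausdorff distance of almost Lorentzian pre-length spaces is $$d_{GH}^-((X,\tau_X),(Y,\tau_Y))=\tfrac12\inf\{\mathrm{dist}(R):R\in\mathrm{Corr}(X,Y)\},$$ where $\mathrm{Corr}(X,Y)$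 is the set of relations $R\subset X\times Y$ whose projections to $X$ and to $Y$ are both surjective, and $\mathrm{dist}(R)=\sup\{|\tau_X(x,x')-\tau_Y(y,y')|:(x,y),(x',y')\in R\}$. "Diverges" means that there is no almost Lorentzian pre-length space to which the sequence converges in $d_{GH}^-$; "precompact" means that every sequence in the family has a $d_{GH}^-$-convergent subsequence. *)

theory Defs
  imports "HOL-Analysis.Analysis"
begin

text \<open>The circle \<open>\<real>/2\<pi>\<int>\<close>.\<close>

definition cong_2pi :: "real \<Rightarrow> real \<Rightarrow> bool" where
  "cong_2pi x y \<longleftrightarrow> (\<exists>k::int. y = x + 2 * pi * of_int k)"

lemma equivp_cong_2pi: "equivp cong_2pi"
proof (rule equivpI)
  show "reflp cong_2pi"
    unfolding reflp_def cong_2pi_def by (auto intro: exI[of _ "0::int"])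
  show "symp cong_2pi"
  proof (rule sympI)
    fix x y assume "cong_2pi x y"
    then obtain k :: int where "y = x + 2 * pi * of_int k"
      by (auto simp: cong_2pi_def)
    then have "x = y + 2 * pi * of_int (- k)" by simp
    then show "cong_2pi y x" unfolding cong_2pi_def by blast
  qed
  show "transp cong_2pi"
  proof (rule transpI)
    fix x y z assume "cong_2pi x y" "cong_2pi y z"
    then obtain k l :: int where "y = x + 2 * pi * of_int k" "z = y + 2 * pi * of_int l"
      by (auto simp: cong_2pi_def)
    then have "z = x + 2 * pi * of_int (k + l)" by (simp add: algebra_simps)
    then show "cong_2pi x z" unfolding cong_2pi_def by blast
  qed
qed

quotient_type circle = real / cong_2pi
  by (rule equivp_cong_2pi)

text \<open>The arc length between two angles: the smallest distance between representatives.\<close>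

lift_definition arc_dist :: "circle \<Rightarrow> circle \<Rightarrow> real"
  is "\<lambda>x y. INF k::int. \<bar>x - y + 2 * pi * of_int k\<bar>"
proof -
  fix x x' y y' assume "cong_2pi x x'" "cong_2pi y y'"
  then obtain m n :: int where mn: "x' = x + 2 * pi * of_int m" "y' = y + 2 * pi * of_int n"
    by (auto simp: cong_2pi_def)
  have "range (\<lambda>k::int. \<bar>x' - y' + 2 * pi * of_int k\<bar>)
      = (\<lambda>k::int. \<bar>x - y + 2 * pi * of_int k\<bar>) ` range (\<lambda>k. k + (m - n))"
    unfolding image_image by (intro image_cong) (simp_all add: mn algebra_simps)
  also have "range (\<lambda>k::int. k + (m - n)) = UNIV"
    by (rule surjI[of _ "\<lambda>k. k - (m - n)"]) simp
  finally show "(INF k::int. \<bar>x - y + 2 * pi * of_int k\<bar>)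
      = (INF k::int. \<bar>x' - y' + 2 * pi * of_int k\<bar>)" by simp
qed

lemma arc_dist_eq_abs:
  assumes "\<bar>x - y\<bar> \<le> pi"
  shows "arc_dist (abs_circle x) (abs_circle y) = \<bar>x - y\<bar>"
proof -
  have "\<bar>x - y\<bar> \<le> \<bar>x - y + 2 * pi * of_int k\<bar>" for k :: int
  proof (cases "k = 0")
    case False
    then have "1 \<le> \<bar>real_of_int k\<bar>" by linarith
    then have "2 * pi \<le> \<bar>2 * pi * of_int k\<bar>"
      by (simp add: abs_mult)
    with assms show ?thesis by linarith
  qed simp
  then have "(INF k::int. \<bar>x - y + 2 * pi * of_int k\<bar>) = \<bar>x - y\<bar>"
    by (intro cInf_eq_minimum) (auto intro: range_eqI[of _ _ "0::int"])
  then show ?thesis by (simp add: arc_dist.abs_eq)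
qed


text \<open>A space is a carrier together with a function, of which only the values on the
  carrier matter.\<close>

type_synonym 'a time_space = "'a set \<times> ('a \<Rightarrow> 'a \<Rightarrow> real)"

definition almost_lorentzian_pre_length_space :: "'a time_space \<Rightarrow> bool" where
  "almost_lorentzian_pre_length_space = (\<lambda>(X, \<tau>).
     (\<forall>x\<in>X. \<forall>y\<in>X. \<tau> x y = - \<tau> y x) \<and>
     (\<forall>x\<in>X. \<forall>y\<in>X. \<forall>z\<in>X. \<tau> x y > 0 \<and> \<tau> y z > 0 \<longrightarrow> \<tau> x z \<ge> \<tau> x y + \<tau> y z))"

definition correspondences :: "'a set \<Rightarrow> 'b set \<Rightarrow> ('a \<times> 'b) set set" where
  "correspondences X Y = {R. R \<subseteq> X \<times> Y \<and> fst ` R = X \<and> snd ` R = Y}"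

text \<open>Distortions and distances take values in \<open>[0,\<infinity>]\<close>, as a time separation function
  may be unbounded and there is no correspondence between an empty and a nonempty set.\<close>

definition distortion ::
  "('a \<Rightarrow> 'a \<Rightarrow> real) \<Rightarrow> ('b \<Rightarrow> 'b \<Rightarrow> real) \<Rightarrow> ('a \<times> 'b) set \<Rightarrow> ennreal" where
  "distortion \<tau> \<sigma> R = (SUP ((x, y), (x', y')) \<in> R \<times> R. ennreal \<bar>\<tau> x x' - \<sigma> y y'\<bar>)"

definition gh_dist :: "'a time_space \<Rightarrow> 'b time_space \<Rightarrow> ennreal" where
  "gh_dist = (\<lambda>(X, \<tau>) (Y, \<sigma>). (INF R \<in> correspondences X Y. distortion \<tau> \<sigma> R) / 2)"

definition gh_converges :: "(nat \<Rightarrow> 'a time_space) \<Rightarrow> 'b time_space \<Rightarrow> bool" where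
  "gh_converges S L \<longleftrightarrow>
     almost_lorentzian_pre_length_space L \<and> (\<lambda>n. gh_dist (S n) L) \<longlonglongrightarrow> 0"

text \<open>HOL cannot quantify over all sets inside a formula, so the type \<open>'b\<close> from which the
  points of limit spaces are drawn is a parameter.  A negative statement about all limit
  spaces has to be made for arbitrary \<open>'b\<close>.\<close>

definition gh_diverges :: "'b itself \<Rightarrow> (nat \<Rightarrow> 'a time_space) \<Rightarrow> bool" where
  "gh_diverges _ S \<longleftrightarrow> \<not> (\<exists>L :: 'b time_space. gh_converges S L)"

definition gh_precompact :: "'b itself \<Rightarrow> 'a time_space set \<Rightarrow> bool" where
  "gh_precompact _ F \<longleftrightarrow>
     (\<forall>S :: nat \<Rightarrow> 'a time_space. range S \<subseteq> F \<longrightarrow>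
        (\<exists>r :: nat \<Rightarrow> nat. strict_mono r \<and> (\<exists>L :: 'b time_space. gh_converges (S \<circ> r) L)))"


definition cyl_carrier :: "(real \<times> circle) set" where
  "cyl_carrier = {0..1} \<times> UNIV"

definition cyl_tau :: "real \<Rightarrow> real \<times> circle \<Rightarrow> real \<times> circle \<Rightarrow> real" where
  "cyl_tau p = (\<lambda>(s, \<alpha>) (t, \<beta>).
     if t - s \<ge> arc_dist \<alpha> \<beta>
     then ((t - s) powr p - arc_dist \<alpha> \<beta> powr p) powr (1 / p)
     else 0)"

definition antisym_version :: "('a \<Rightarrow> 'a \<Rightarrow> real) \<Rightarrow> 'a \<Rightarrow> 'a \<Rightarrow> real" where
  "antisym_version \<tau> x y = \<tau> x y - \<tau> y x"

definition Cyl :: "real \<Rightarrow> (real \<times> circle) time_space" where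
  "Cyl p = (cyl_carrier, antisym_version (cyl_tau p))"

end

theory Submission
  imports Defs
begin

text \<open>
  Continuity in \<open>p\<close>.  On the cylinder, \<open>\<tau>\<^sup>p\<close> is a function of \<open>p\<close>, the time difference and the
  arc distance that is jointly continuous (\<open>continuous_on_tau_profile\<close>).  The last two range over
  compact intervals, so this function is uniformly continuous for bounded \<open>p\<close>, and the identity
  correspondence between \<open>Cyl\<^sup>p\<close> and \<open>Cyl\<^sup>q\<close> has small distortion when \<open>q\<close> is close to \<open>p\<close>.

  Divergence.  The pointwise limit of \<open>\<tau>\<^sup>p\<close> jumps from the time difference to \<open>0\<close> across the light
  cone, and this jump makes the spaces too large in the limit.  Call points \<open>c\<close>-separated if for any two
  of them, \<open>x\<close> and \<open>x'\<close>, some point \<open>z\<close> satisfies \<open>\<bar>\<tau> x z - \<tau> x' z\<bar> \<ge> c\<close>.  Three facts contradict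
  convergence of a subsequence.

  \<^item> For each \<open>N\<close>, the space \<open>Cyl\<^sup>p\<close> has \<open>N\<close> points that are \<open>1/2\<close>-separated as soon as \<open>p\<close> is large
    (\<open>eventually_has_separated_family_Cyl\<close>): of two points at time \<open>0\<close>, one lies on the past light cone
    of a suitable \<open>z\<close> at time \<open>1\<close> and the other strictly inside it.
  \<^item> For a single \<open>p\<close>, the number of \<open>c\<close>-separated points in \<open>Cyl\<^sup>p\<close> is bounded
    (\<open>not_has_separated_family_Cyl\<close>), by compactness and uniform continuity of \<open>\<tau>\<^sup>p\<close>.
  \<^item> Separated families pass between spaces at small distance, with a small loss in \<open>c\<close>
    (\<open>has_separated_family_map\<close>).

  If a subsequence converged to \<open>L\<close>, one member of it near \<open>L\<close> would bound the number of \<open>3/8\<close>-separated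
  points in \<open>L\<close>, while later members would provide arbitrarily many.
\<close>

section \<open>The arc distance on the circle\<close>

lemma arc_dist_le_representatives:
  "arc_dist (abs_circle x) (abs_circle y) \<le> \<bar>x - y + 2 * pi * of_int k\<bar>"
  unfolding arc_dist.abs_eq by (rule cINF_lower) (auto intro: bdd_belowI[of _ 0])

lemma le_arc_distI:
  assumes "\<And>k::int. c \<le> \<bar>x - y + 2 * pi * of_int k\<bar>"
  shows "c \<le> arc_dist (abs_circle x) (abs_circle y)"
  unfolding arc_dist.abs_eq using assms by (intro cINF_greatest) auto

lemma abs_circle_surj: obtains x where "\<alpha> = abs_circle x"
  by (metis Quotient_abs_rep[OF Quotient_circle])

lemma arc_dist_nonneg: "0 \<le> arc_dist \<alpha> \<beta>"
  by (metis abs_circle_surj abs_ge_zero le_arc_distI)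

lemma arc_dist_commute: "arc_dist \<alpha> \<beta> = arc_dist \<beta> \<alpha>"
proof -
  obtain x y where xy: "\<alpha> = abs_circle x" "\<beta> = abs_circle y" by (metis abs_circle_surj)
  have "arc_dist (abs_circle x) (abs_circle y) \<le> arc_dist (abs_circle y) (abs_circle x)" for x y
  proof (rule le_arc_distI)
    fix k :: int
    show "arc_dist (abs_circle x) (abs_circle y) \<le> \<bar>y - x + 2 * pi * of_int k\<bar>"
      using arc_dist_le_representatives[of x y "- k"] by simp
  qed
  then show ?thesis unfolding xy by (intro antisym)
qed

lemma arc_dist_Lipschitz_left:
  "\<bar>arc_dist (abs_circle a) \<beta> - arc_dist (abs_circle b) \<beta>\<bar> \<le> \<bar>a - b\<bar>"
proof -
  obtain c where \<beta>: "\<beta> = abs_circle c" by (rule abs_circle_surj)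
  have "arc_dist (abs_circle a) \<beta> - \<bar>a - b\<bar> \<le> arc_dist (abs_circle b) \<beta>" for a b
    unfolding \<beta>
  proof (rule le_arc_distI)
    fix k :: int
    show "arc_dist (abs_circle a) (abs_circle c) - \<bar>a - b\<bar> \<le> \<bar>b - c + 2 * pi * of_int k\<bar>"
      using arc_dist_le_representatives[of a c k] by linarith
  qed
  from this[of a b] this[of b a] show ?thesis by linarith
qed

lemma circle_representative:
  obtains a where "a \<in> {0..2*pi}" "\<alpha> = abs_circle a"
proof -
  obtain c where c: "\<alpha> = abs_circle c"
    by (rule abs_circle_surj)
  define a where "a = c - 2 * pi * of_int \<lfloor>c / (2 * pi)\<rfloor>"
  have a: "a = 2 * pi * frac (c / (2*pi))"
    by (simp add: a_def frac_def right_diff_distrib)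
  have "2 * pi * frac (c / (2*pi)) \<le> 2 * pi * 1"
    using frac_lt_1[of "c / (2*pi)"] by (intro mult_left_mono) auto
  then have "a \<in> {0..2*pi}" unfolding a by simp
  moreover have "cong_2pi c a"
    unfolding cong_2pi_def a_def by (rule exI[of _ "- \<lfloor>c / (2 * pi)\<rfloor>"]) simp
  then have "\<alpha> = abs_circle a" by (simp add: c circle.abs_eq_iff)
  ultimately show thesis by (rule that)
qed

lemma arc_dist_le: "arc_dist \<alpha> \<beta> \<le> 2 * pi"
proof -
  obtain a b where "a \<in> {0..2*pi}" "\<alpha> = abs_circle a" "b \<in> {0..2*pi}" "\<beta> = abs_circle b"
    by (metis circle_representative)
  then show ?thesis using arc_dist_le_representatives[of a b 0] by auto
qed

section \<open>The time separation as a function of time difference and arc distance\<close>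

text \<open>Truncating the time difference and the difference of powers at \<open>0\<close> absorbs the case distinction
  in the definition of \<open>\<tau>\<^sup>p\<close>, so that continuity across the light cone is visible from the formula.\<close>

definition tau_profile :: "real \<Rightarrow> real \<Rightarrow> real \<Rightarrow> real" where
  "tau_profile p u d = max 0 (max 0 u powr p - d powr p) powr (1 / p)"

lemma cyl_tau_eq_profile:
  assumes "p \<ge> 1"
  shows "cyl_tau p (s, \<alpha>) (t, \<beta>) = tau_profile p (t - s) (arc_dist \<alpha> \<beta>)"
proof (cases "arc_dist \<alpha> \<beta> \<le> t - s")
  case True
  then have "arc_dist \<alpha> \<beta> powr p \<le> (t - s) powr p"
    using assms arc_dist_nonneg[of \<alpha> \<beta>] by (intro powr_mono2) auto
  then show ?thesis
    using True arc_dist_nonneg[of \<alpha> \<beta>] by (simp add: cyl_tau_def tau_profile_def max_def)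
next
  case False
  then have "max 0 (t - s) powr p \<le> arc_dist \<alpha> \<beta> powr p"
    using assms arc_dist_nonneg[of \<alpha> \<beta>] by (intro powr_mono2) auto
  then show ?thesis using False by (simp add: cyl_tau_def tau_profile_def max_def)
qed

text \<open>The bases of the powers may vanish; continuity persists there because the exponents \<open>p\<close> and
  \<open>1 / p\<close> are positive.\<close>

lemma continuous_on_tau_profile:
  "continuous_on ({1..} \<times> UNIV \<times> {0..}) (\<lambda>(p, u, d). tau_profile p u d)"
  unfolding tau_profile_def split_beta
  by (intro continuous_on_powr' continuous_intros) auto

text \<open>The intervals for \<open>u\<close> and \<open>d\<close> contain all time differences and arc distances on the cylinder.
  Continuity in \<open>p\<close> of the spaces uses this with \<open>p\<close> varying, and the bound on separated families with
  \<open>p\<close> fixed.\<close>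

lemma uniformly_continuous_tau_profile:
  assumes "e > 0"
  obtains \<delta> where "\<delta> > 0" and
    "\<And>p q u v d d'. \<lbrakk>p \<in> {1..b}; q \<in> {1..b}; \<bar>u\<bar> \<le> 1; \<bar>v\<bar> \<le> 1; d \<in> {0..2*pi}; d' \<in> {0..2*pi};
       \<bar>p - q\<bar> < \<delta>; \<bar>u - v\<bar> < \<delta>; \<bar>d - d'\<bar> < \<delta>\<rbrakk>
      \<Longrightarrow> \<bar>tau_profile p u d - tau_profile q v d'\<bar> < e"
proof -
  let ?K = "{1..b} \<times> {-1..1::real} \<times> {0..2*pi}"
  have "uniformly_continuous_on ?K (\<lambda>(p, u, d). tau_profile p u d)"
    by (intro compact_uniformly_continuous compact_Times
        continuous_on_subset[OF continuous_on_tau_profile]) auto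
  then obtain \<delta> where "\<delta> > 0" and \<delta>: "\<And>x y. \<lbrakk>x \<in> ?K; y \<in> ?K; dist y x < \<delta>\<rbrakk>
      \<Longrightarrow> dist (case y of (p, u, d) \<Rightarrow> tau_profile p u d) (case x of (p, u, d) \<Rightarrow> tau_profile p u d) < e"
    using assms unfolding uniformly_continuous_on_def by metis
  show thesis
  proof (rule that[of "\<delta> / 3"])
    fix p q u v d d' :: real
    assume A: "p \<in> {1..b}" "q \<in> {1..b}" "\<bar>u\<bar> \<le> 1" "\<bar>v\<bar> \<le> 1" "d \<in> {0..2*pi}" "d' \<in> {0..2*pi}"
       "\<bar>p - q\<bar> < \<delta> / 3" "\<bar>u - v\<bar> < \<delta> / 3" "\<bar>d - d'\<bar> < \<delta> / 3"
    have "dist (p, u, d) (q, v, d') \<le> dist p q + dist (u, d) (v, d')"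
      unfolding dist_Pair_Pair[of p] by (rule sqrt_sum_squares_le_sum) auto
    also have "dist (u, d) (v, d') \<le> dist u v + dist d d'"
      unfolding dist_Pair_Pair by (rule sqrt_sum_squares_le_sum) auto
    finally have "dist (p, u, d) (q, v, d') < \<delta>" using A by (simp add: dist_real_def)
    then show "\<bar>tau_profile p u d - tau_profile q v d'\<bar> < e"
      using \<delta>[of "(q, v, d')" "(p, u, d)"] A by (simp add: dist_real_def abs_le_iff)
  qed (use \<open>\<delta> > 0\<close> in simp)
qed

section \<open>Bounds on the Gromov--Hausdorff distance\<close>

lemma gh_dist_same_carrier_le:
  assumes "\<And>x y. \<lbrakk>x \<in> X; y \<in> X\<rbrakk> \<Longrightarrow> \<bar>\<tau> x y - \<sigma> x y\<bar> \<le> 2 * e"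
  shows "gh_dist (X, \<tau>) (X, \<sigma>) \<le> ennreal e"
proof -
  have "Id_on X \<in> correspondences X X"
    unfolding correspondences_def by (auto simp: Id_on_def image_iff)
  then have "(INF R \<in> correspondences X X. distortion \<tau> \<sigma> R) \<le> distortion \<tau> \<sigma> (Id_on X)"
    by (rule INF_lower)
  also have "\<dots> \<le> ennreal (2 * e)"
    unfolding distortion_def by (rule SUP_least) (auto intro!: ennreal_leI assms)
  also have "\<dots> = ennreal e * 2"
    by (subst ennreal_mult') (simp_all add: mult.commute)
  finally show ?thesis
    unfolding gh_dist_def by (simp add: divide_le_posI_ennreal mult.commute)
qed

text \<open>Choosing a partner for each point turns a correspondence into maps in both directions.  Two
  unrelated maps suffice for transporting finite families of points.\<close>

lemma gh_dist_less_imp_maps: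
  assumes "gh_dist (X, \<tau>) (Y, \<sigma>) < ennreal e"
  obtains f g where "f ` X \<subseteq> Y" "g ` Y \<subseteq> X"
    "\<And>x x'. \<lbrakk>x \<in> X; x' \<in> X\<rbrakk> \<Longrightarrow> \<bar>\<tau> x x' - \<sigma> (f x) (f x')\<bar> \<le> 2 * e"
    "\<And>y y'. \<lbrakk>y \<in> Y; y' \<in> Y\<rbrakk> \<Longrightarrow> \<bar>\<tau> (g y) (g y') - \<sigma> y y'\<bar> \<le> 2 * e"
proof -
  have "e \<ge> 0" using assms by (metis ennreal_neg linorder_le_cases not_less_zero)
  let ?I = "INF R \<in> correspondences X Y. distortion \<tau> \<sigma> R"
  have "?I < ennreal (2 * e)"
  proof (rule ccontr)
    assume "\<not> ?I < ennreal (2 * e)"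
    then have "ennreal (2 * e) / 2 \<le> ?I / 2"
      by (intro divide_right_mono_ennreal) simp
    moreover have "ennreal (2 * e) / 2 = ennreal e"
      using \<open>e \<ge> 0\<close> by (simp add: ennreal_divide_numeral)
    ultimately show False using assms by (simp add: gh_dist_def)
  qed
  then obtain R where R: "R \<in> correspondences X Y" "distortion \<tau> \<sigma> R < ennreal (2 * e)"
    by (auto simp: INF_less_iff)
  have close: "\<bar>\<tau> x x' - \<sigma> y y'\<bar> \<le> 2 * e" if "(x, y) \<in> R" "(x', y') \<in> R" for x x' y y'
  proof -
    have "ennreal \<bar>\<tau> x x' - \<sigma> y y'\<bar> \<le> distortion \<tau> \<sigma> R"
      unfolding distortion_def using that by (intro SUP_upper2[of "((x, y), (x', y'))"]) auto
    then have "ennreal \<bar>\<tau> x x' - \<sigma> y y'\<bar> \<le> ennreal (2 * e)" using R by simp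
    then show ?thesis using \<open>e \<ge> 0\<close> by simp
  qed
  have sub: "R \<subseteq> X \<times> Y" and "fst ` R = X" "snd ` R = Y"
    using R by (auto simp: correspondences_def)
  then have "\<forall>x\<in>X. \<exists>y. (x, y) \<in> R" "\<forall>y\<in>Y. \<exists>x. (x, y) \<in> R" by force+
  then obtain f g where "\<forall>x\<in>X. (x, f x) \<in> R" "\<forall>y\<in>Y. (g y, y) \<in> R" by metis
  then show thesis using sub close by (intro that[of f g]) blast+
qed

section \<open>Separated families\<close>

text \<open>Points are compared by their functions \<open>\<tau> x\<close> in the supremum distance, which makes sense
  for any \<open>\<tau>\<close>.  The family is indexed so that its points are counted without assuming them distinct;
  for \<open>c > 0\<close> they are.\<close>

definition has_separated_family :: "'a time_space \<Rightarrow> real \<Rightarrow> nat \<Rightarrow> bool" where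
  "has_separated_family = (\<lambda>(X, \<tau>) c N. \<exists>x. (\<forall>i<N. x i \<in> X) \<and>
     (\<forall>j<N. \<forall>i<j. \<exists>z\<in>X. c \<le> \<bar>\<tau> (x i) z - \<tau> (x j) z\<bar>))"

text \<open>The point \<open>f z\<close> separates the images; each of the two values of \<open>\<tau>\<close> moves by at most \<open>e\<close>.\<close>

lemma has_separated_family_map:
  assumes "has_separated_family (X, \<tau>) c N" "f ` X \<subseteq> Y"
    and close: "\<And>x x'. \<lbrakk>x \<in> X; x' \<in> X\<rbrakk> \<Longrightarrow> \<bar>\<tau> x x' - \<sigma> (f x) (f x')\<bar> \<le> e"
  shows "has_separated_family (Y, \<sigma>) (c - 2 * e) N"
proof -
  obtain x where x: "\<forall>i<N. x i \<in> X" "\<forall>j<N. \<forall>i<j. \<exists>z\<in>X. c \<le> \<bar>\<tau> (x i) z - \<tau> (x j) z\<bar>"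
    using assms(1) by (auto simp: has_separated_family_def)
  have "\<exists>z\<in>Y. c - 2 * e \<le> \<bar>\<sigma> (f (x i)) z - \<sigma> (f (x j)) z\<bar>" if ij: "j < N" "i < j" for i j
  proof -
    obtain z where z: "z \<in> X" "c \<le> \<bar>\<tau> (x i) z - \<tau> (x j) z\<bar>" using x ij by blast
    have "c - 2 * e \<le> \<bar>\<sigma> (f (x i)) (f z) - \<sigma> (f (x j)) (f z)\<bar>"
      using z close[of "x i" z] close[of "x j" z] x(1) ij by fastforce
    then show ?thesis using z assms(2) by blast
  qed
  then show ?thesis
    using x(1) assms(2) unfolding has_separated_family_def
    by (auto intro!: exI[of _ "f \<circ> x"])
qed

text \<open>Lift the cylinder to the rectangle \<open>[0,1] \<times> [0,2\<pi>]\<close> and cover this by finitely many balls so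
  small that points over the same ball have \<open>\<tau>\<^sup>p\<close>-functions less than \<open>c\<close> apart.  By the pigeonhole
  principle there is no \<open>c\<close>-separated family with more points than balls.\<close>

lemma not_has_separated_family_Cyl:
  assumes "p \<ge> 1" "c > 0"
  obtains M where "\<not> has_separated_family (Cyl p) c M"
proof -
  obtain \<delta> where "\<delta> > 0" and \<delta>: "\<And>u v d d'. \<lbrakk>\<bar>u\<bar> \<le> 1; \<bar>v\<bar> \<le> 1; d \<in> {0..2*pi}; d' \<in> {0..2*pi};
       \<bar>u - v\<bar> < \<delta>; \<bar>d - d'\<bar> < \<delta>\<rbrakk> \<Longrightarrow> \<bar>tau_profile p u d - tau_profile p v d'\<bar> < c / 2"
    using uniformly_continuous_tau_profile[of "c / 2" p] assms
    by (metis abs_zero atLeastAtMost_iff diff_self half_gt_zero order_refl)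
  let ?K = "{0..1::real} \<times> {0..2*pi}"
  have "\<exists>k. finite k \<and> k \<subseteq> ?K \<and> ?K \<subseteq> (\<Union>x\<in>k. ball x (\<delta> / 2))"
    using seq_compact_imp_totally_bounded[of ?K] \<open>\<delta> > 0\<close>
    by (auto simp: seq_compact_eq_compact compact_Times)
  then obtain k where k: "finite k" "?K \<subseteq> (\<Union>x\<in>k. ball x (\<delta> / 2))" by blast
  have near: "\<bar>antisym_version (cyl_tau p) (s, abs_circle a) z
      - antisym_version (cyl_tau p) (s', abs_circle a') z\<bar> < c"
    if "s \<in> {0..1}" "s' \<in> {0..1}" "z \<in> cyl_carrier" "dist (s, a) (s', a') < \<delta>" for s s' a a' z
  proof -
    obtain t \<beta> where z: "z = (t, \<beta>)" "t \<in> {0..1}"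
      using \<open>z \<in> cyl_carrier\<close> by (auto simp: cyl_carrier_def)
    have "\<bar>s - s'\<bar> < \<delta>" "\<bar>a - a'\<bar> < \<delta>"
      using that(4) dist_fst_le[of "(s, a)" "(s', a')"] dist_snd_le[of "(s, a)" "(s', a')"]
      by (auto simp: dist_real_def)
    moreover define d d' where "d = arc_dist (abs_circle a) \<beta>" "d' = arc_dist (abs_circle a') \<beta>"
    moreover have "d \<in> {0..2*pi}" "d' \<in> {0..2*pi}"
      by (auto simp: d_d'_def arc_dist_nonneg arc_dist_le)
    moreover have "\<bar>d - d'\<bar> \<le> \<bar>a - a'\<bar>"
      by (simp add: d_d'_def arc_dist_Lipschitz_left)
    ultimately have "\<bar>tau_profile p (t - s) d - tau_profile p (t - s') d'\<bar> < c / 2"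
      "\<bar>tau_profile p (s - t) d - tau_profile p (s' - t) d'\<bar> < c / 2"
      using that z by (intro \<delta>; auto)+
    then show ?thesis
      unfolding z antisym_version_def cyl_tau_eq_profile[OF assms(1)] arc_dist_commute[of \<beta>] d_d'_def[symmetric]
      by linarith
  qed
  have "\<not> has_separated_family (Cyl p) c (Suc (card k))"
  proof
    assume "has_separated_family (Cyl p) c (Suc (card k))"
    then obtain x where x: "\<forall>i<Suc (card k). x i \<in> cyl_carrier"
      "\<forall>j<Suc (card k). \<forall>i<j. \<exists>z\<in>cyl_carrier. c \<le> \<bar>antisym_version (cyl_tau p) (x i) z
          - antisym_version (cyl_tau p) (x j) z\<bar>"
      by (auto simp: has_separated_family_def Cyl_def)
    have "\<exists>s a y. x i = (s, abs_circle a) \<and> s \<in> {0..1} \<and> y \<in> k \<and> dist y (s, a) < \<delta> / 2"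
      if i: "i < Suc (card k)" for i
    proof -
      obtain s \<alpha> where "x i = (s, \<alpha>)" "s \<in> {0..1}" using x(1) i
        by (cases "x i") (auto simp: cyl_carrier_def)
      moreover obtain a where "a \<in> {0..2*pi}" "\<alpha> = abs_circle a" by (rule circle_representative)
      moreover obtain y where "y \<in> k" "(s, a) \<in> ball y (\<delta> / 2)"
        using k(2) calculation by blast
      ultimately show ?thesis unfolding mem_ball by blast
    qed
    then obtain s a y where y: "\<And>i. i < Suc (card k) \<Longrightarrow> x i = (s i, abs_circle (a i)) \<and> s i \<in> {0..1}
        \<and> y i \<in> k \<and> dist (y i) (s i, a i) < \<delta> / 2" by metis
    have "card (y ` {..<Suc (card k)}) \<le> card k"
      using y k(1) by (intro card_mono) auto
    then have "\<not> inj_on y {..<Suc (card k)}"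
      using card_image[of y "{..<Suc (card k)}"] by auto
    then obtain i j where ij: "i < j" "j < Suc (card k)" "y i = y j"
      unfolding inj_on_def by (metis lessThan_iff linorder_neqE_nat)
    then have "dist (s i, a i) (s j, a j) < \<delta>"
      using y[of i] y[of j] dist_triangle_half_r[of "y i" "(s i, a i)" \<delta> "(s j, a j)"] by simp
    moreover obtain z where "z \<in> cyl_carrier" "c \<le> \<bar>antisym_version (cyl_tau p) (x i) z
          - antisym_version (cyl_tau p) (x j) z\<bar>" using x(2) ij by blast
    ultimately show False
      using near[of "s i" "s j" z "a i" "a j"] y[of i] y[of j] ij by simp
  qed
  then show thesis by (rule that)
qed

text \<open>Place \<open>N\<close> points at time \<open>0\<close> at the angles \<open>i / N\<close>.  For \<open>i < j\<close> let \<open>z\<close> be the point at time \<open>1\<close>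
  with angle \<open>j / N - 1\<close>.  The arc distance from the \<open>j\<close>-th point to \<open>z\<close> is exactly \<open>1\<close>, so \<open>\<tau>\<^sup>p\<close> vanishes
  there.  From the \<open>i\<close>-th point it is at most \<open>r = 1 - 1 / N\<close>, so \<open>\<tau>\<^sup>p\<close> is at least
  \<open>(1 - r\<^sup>p)\<^bsup>1/p\<^esup> \<ge> 1 - r\<^sup>p\<close>, which tends to \<open>1\<close>.\<close>

lemma eventually_has_separated_family_Cyl:
  "\<forall>\<^sub>F n in sequentially. has_separated_family (Cyl (real (Suc n))) (1/2) N"
proof (cases "N = 0")
  case True
  then show ?thesis by (simp add: has_separated_family_def Cyl_def)
next
  case False
  let ?r = "1 - 1 / real N"
  have r: "0 \<le> ?r" "?r < 1" using False by auto
  have "(\<lambda>n. ?r ^ n) \<longlonglongrightarrow> 0" using r by (intro LIMSEQ_realpow_zero) auto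
  then have "\<forall>\<^sub>F n in sequentially. ?r ^ n < 1/2" by (rule order_tendstoD) simp
  then have "\<forall>\<^sub>F n in sequentially. ?r ^ Suc n < 1/2"
    by (rule eventually_sequentially_Suc[THEN iffD2])
  then show ?thesis
  proof (rule eventually_mono)
    fix n assume n: "?r ^ Suc n < 1/2"
    let ?p = "real (Suc n)"
    let ?x = "\<lambda>i. (0::real, abs_circle (real i / real N))"
    let ?\<tau> = "antisym_version (cyl_tau ?p)"
    have "\<exists>z\<in>cyl_carrier. 1/2 \<le> \<bar>?\<tau> (?x i) z - ?\<tau> (?x j) z\<bar>" if ij: "j < N" "i < j" for i j
    proof -
      let ?z = "(1::real, abs_circle (real j / real N - 1))"
      let ?d = "1 - (real j - real i) / real N"
      have "0 \<le> ?d" using ij by (auto simp: field_simps)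
      moreover have "1 / real N \<le> (real j - real i) / real N"
        using ij by (intro divide_right_mono) auto
      ultimately have d: "0 \<le> ?d" "?d \<le> ?r" by auto
      have "real i / real N - (real j / real N - 1) = ?d" by (simp add: field_simps diff_divide_distrib)
      then have di: "arc_dist (abs_circle (real i / real N)) (abs_circle (real j / real N - 1)) = ?d"
        using arc_dist_eq_abs[of "real i / real N" "real j / real N - 1"] d r pi_gt3 by simp
      have dj: "arc_dist (abs_circle (real j / real N)) (abs_circle (real j / real N - 1)) = 1"
        using arc_dist_eq_abs[of "real j / real N" "real j / real N - 1"] pi_gt3 by simp
      have past: "cyl_tau ?p ?z (?x l) = 0" for l
        using arc_dist_nonneg[of "abs_circle (real j / real N - 1)" "abs_circle (real l / real N)"]
        by (simp add: cyl_tau_def)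
      have j0: "?\<tau> (?x j) ?z = 0"
        unfolding antisym_version_def past by (simp add: cyl_tau_def dj)
      have "?d powr ?p \<le> ?r powr ?p" using d by (intro powr_mono2) auto
      also have "\<dots> = ?r ^ Suc n" using r by (intro powr_realpow') auto
      also have "\<dots> < 1/2" by (rule n)
      finally have less: "?d powr ?p < 1/2" .
      have "1/2 \<le> (1 - ?d powr ?p) powr 1" using less by simp
      also have "\<dots> \<le> (1 - ?d powr ?p) powr (1 / ?p)"
        using less by (intro powr_mono') auto
      also have "\<dots> = ?\<tau> (?x i) ?z"
        unfolding antisym_version_def past using d r ij by (simp add: cyl_tau_def di)
      finally show ?thesis using j0 by (intro bexI[of _ ?z]) (auto simp: cyl_carrier_def)
    qed
    then show "has_separated_family (Cyl ?p) (1/2) N"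
      unfolding has_separated_family_def Cyl_def prod.case
      by (intro exI[of _ ?x]) (auto simp: cyl_carrier_def)
  qed
qed

section \<open>Divergence, continuity and the pointwise limit\<close>

text \<open>Divergence is the case of the identity subsequence, and the general case gives failure of
  precompactness.\<close>

lemma Cyl_subsequence_not_gh_converges:
  assumes "strict_mono r"
  shows "\<not> gh_converges ((\<lambda>n. Cyl (real (Suc n))) \<circ> r) L"
proof
  assume "gh_converges ((\<lambda>n. Cyl (real (Suc n))) \<circ> r) L"
  then have "(\<lambda>k. gh_dist (Cyl (real (Suc (r k)))) L) \<longlonglongrightarrow> 0"
    by (simp add: gh_converges_def o_def)
  (* At distance below 1/32 the maps distort by at most 1/16, so each passage costs 1/8 of
     separation; the passages into and out of L turn 1/2 into 1/4. *)
  then have close: "\<forall>\<^sub>F k in sequentially. gh_dist (Cyl (real (Suc (r k)))) L < ennreal (1/32)"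
    by (rule order_tendstoD) simp
  obtain Y \<sigma> where L: "L = (Y, \<sigma>)" by (cases L)
  obtain k0 where k0: "gh_dist (Cyl (real (Suc (r k0)))) L < ennreal (1/32)"
    using close eventually_happens' sequentially_bot by blast
  obtain M where M: "\<not> has_separated_family (Cyl (real (Suc (r k0)))) (1/4) M"
    by (rule not_has_separated_family_Cyl[of "real (Suc (r k0))" "1/4"]) auto
  have "\<forall>\<^sub>F k in sequentially. has_separated_family (Cyl (real (Suc (r k)))) (1/2) M"
    using eventually_has_separated_family_Cyl filterlim_subseq[OF assms]
    by (rule eventually_compose_filterlim)
  with close obtain k where k: "gh_dist (Cyl (real (Suc (r k)))) L < ennreal (1/32)"
      "has_separated_family (Cyl (real (Suc (r k)))) (1/2) M"
    using eventually_happens'[OF sequentially_bot eventually_conj] by blast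
  obtain f g where "f ` cyl_carrier \<subseteq> Y"
    "\<And>x x'. \<lbrakk>x \<in> cyl_carrier; x' \<in> cyl_carrier\<rbrakk> \<Longrightarrow>
       \<bar>antisym_version (cyl_tau (real (Suc (r k)))) x x' - \<sigma> (f x) (f x')\<bar> \<le> 2 * (1/32)"
    by (rule gh_dist_less_imp_maps[OF k(1)[unfolded L Cyl_def]]) blast
  from has_separated_family_map[OF k(2)[unfolded Cyl_def] this]
  have L_family: "has_separated_family (Y, \<sigma>) (1/2 - 2 * (2 * (1/32))) M" .
  obtain f g where g: "g ` Y \<subseteq> cyl_carrier"
    "\<And>y y'. \<lbrakk>y \<in> Y; y' \<in> Y\<rbrakk> \<Longrightarrow>
       \<bar>antisym_version (cyl_tau (real (Suc (r k0)))) (g y) (g y') - \<sigma> y y'\<bar> \<le> 2 * (1/32)"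
    by (rule gh_dist_less_imp_maps[OF k0[unfolded L Cyl_def]]) blast
  have "has_separated_family (Cyl (real (Suc (r k0)))) (1/2 - 2 * (2 * (1/32)) - 2 * (2 * (1/32))) M"
    unfolding Cyl_def
    by (rule has_separated_family_map[OF L_family g(1)]) (metis g(2) abs_minus_commute)
  with M show False by simp
qed

lemma gh_dist_Cyl_tendsto:
  assumes "p \<ge> 1"
  shows "((\<lambda>q. gh_dist (Cyl p) (Cyl q)) \<longlongrightarrow> 0) (at p within {1..})"
proof (rule order_tendstoI)
  fix a :: ennreal assume "0 < a"
  then obtain e where e: "0 < ennreal e" "ennreal e < a"
    by (metis dense ennreal_cases top.extremum_strict)
  then have "e > 0" by simp
  then obtain \<delta> where "\<delta> > 0" and \<delta>: "\<And>p' q u d. \<lbrakk>p' \<in> {1..p+1}; q \<in> {1..p+1}; \<bar>u\<bar> \<le> 1; d \<in> {0..2*pi};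
       \<bar>p' - q\<bar> < \<delta>\<rbrakk> \<Longrightarrow> \<bar>tau_profile p' u d - tau_profile q u d\<bar> < e"
    using uniformly_continuous_tau_profile[of e "p+1"]
    by (metis abs_zero diff_self)
  (* The antisymmetric version has two terms, each changing by less than e, and the
     Gromov-Hausdorff distance halves the distortion. *)
  have "gh_dist (Cyl p) (Cyl q) < a" if q: "q \<ge> 1" "\<bar>q - p\<bar> < min \<delta> 1" for q
  proof -
    have close: "\<bar>cyl_tau p x y - cyl_tau q x y\<bar> < e" if "x \<in> cyl_carrier" "y \<in> cyl_carrier" for x y
    proof -
      obtain s \<alpha> t \<beta> where xy: "x = (s, \<alpha>)" "y = (t, \<beta>)" by (meson surj_pair)
      show ?thesis unfolding xy cyl_tau_eq_profile[OF assms] cyl_tau_eq_profile[OF q(1)]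
        by (rule \<delta>) (use assms q that xy in \<open>auto simp: cyl_carrier_def arc_dist_nonneg arc_dist_le\<close>)
    qed
    have "gh_dist (Cyl p) (Cyl q) \<le> ennreal e"
      unfolding Cyl_def
    proof (rule gh_dist_same_carrier_le)
      fix x y assume "x \<in> cyl_carrier" "y \<in> cyl_carrier"
      then show "\<bar>antisym_version (cyl_tau p) x y - antisym_version (cyl_tau q) x y\<bar> \<le> 2 * e"
        using close[of x y] close[of y x] unfolding antisym_version_def by linarith
    qed
    then show ?thesis using e by simp
  qed
  then show "\<forall>\<^sub>F q in at p within {1..}. gh_dist (Cyl p) (Cyl q) < a"
    unfolding eventually_at using \<open>\<delta> > 0\<close>
    by (intro exI[of _ "min \<delta> 1"]) (auto simp: dist_real_def)
qed simp

text \<open>Factoring out \<open>u\<close> leaves \<open>(1 - (d/u)\<^sup>n)\<^bsup>1/n\<^esup>\<close>, whose base and exponent tend to \<open>1\<close> and \<open>0\<close>.\<close>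

lemma powr_diff_powr_inverse_tendsto:
  fixes u d :: real
  assumes "0 \<le> d" "d < u"
  shows "(\<lambda>n. (u powr real (Suc n) - d powr real (Suc n)) powr (1 / real (Suc n))) \<longlonglongrightarrow> u"
proof -
  have "(\<lambda>n. (d / u) ^ n) \<longlonglongrightarrow> 0" using assms by (intro LIMSEQ_realpow_zero) auto
  then have "(\<lambda>n. 1 - (d / u) ^ Suc n) \<longlonglongrightarrow> 1 - 0"
    by (rule tendsto_diff[OF tendsto_const LIMSEQ_Suc])
  moreover have "(\<lambda>n. 1 / real (Suc n)) \<longlonglongrightarrow> 0"
    using LIMSEQ_inverse_real_of_nat by (simp add: inverse_eq_divide)
  ultimately have "(\<lambda>n. u * (1 - (d / u) ^ Suc n) powr (1 / real (Suc n))) \<longlonglongrightarrow> u * (1 - 0) powr 0"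
    by (intro tendsto_mult[OF tendsto_const] tendsto_powr) (assumption | simp)+
  moreover have "u * (1 - (d / u) ^ Suc n) powr (1 / real (Suc n))
      = (u powr real (Suc n) - d powr real (Suc n)) powr (1 / real (Suc n))" for n
  proof -
    have "(d / u) ^ Suc n \<le> 1" using assms by (intro power_le_one) auto
    moreover have "(d / u) ^ Suc n = d powr real (Suc n) / u powr real (Suc n)"
      using assms by (simp add: powr_realpow'[symmetric] powr_divide del: power_Suc of_nat_Suc)
    moreover have "u powr real (Suc n) - d powr real (Suc n)
        = u powr real (Suc n) * (1 - d powr real (Suc n) / u powr real (Suc n))"
      using assms by (simp add: field_simps)
    ultimately show ?thesis
      using assms by (simp add: powr_mult powr_powr del: power_Suc of_nat_Suc)
  qed
  ultimately show ?thesis by simp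
qed

text \<open>The limit is the full time difference strictly inside the light cone and \<open>0\<close> on it: this jump is
  the source of the divergence.\<close>

lemma cyl_tau_pointwise_tendsto:
  "(\<lambda>n. cyl_tau (real (Suc n)) (s, \<alpha>) (t, \<beta>))
     \<longlonglongrightarrow> (if arc_dist \<alpha> \<beta> < t - s then t - s else 0)"
proof (cases "arc_dist \<alpha> \<beta> < t - s")
  case True
  then show ?thesis
    using powr_diff_powr_inverse_tendsto[OF arc_dist_nonneg True] by (simp add: cyl_tau_def)
next
  case False
  then have "cyl_tau (real (Suc n)) (s, \<alpha>) (t, \<beta>) = 0" for n
    by (cases "arc_dist \<alpha> \<beta> = t - s") (auto simp: cyl_tau_def)
  then show ?thesis using False by simp
qed

theorem lemma3p8:
  shows "(\<forall>p\<ge>1. ((\<lambda>q. gh_dist (Cyl p) (Cyl q)) \<longlongrightarrow> 0) (at p within {1..}))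
    \<and> gh_diverges TYPE('b) (\<lambda>n. Cyl (real (Suc n)))
    \<and> \<not> gh_precompact TYPE('b) {Cyl (real n) | n::nat. n \<ge> 1}
    \<and> (\<exists>\<tau>_lim. \<forall>x\<in>cyl_carrier. \<forall>y\<in>cyl_carrier.
          (\<lambda>n. cyl_tau (real (Suc n)) x y) \<longlonglongrightarrow> \<tau>_lim x y)"
proof (intro conjI)
  show "\<forall>p\<ge>1. ((\<lambda>q. gh_dist (Cyl p) (Cyl q)) \<longlongrightarrow> 0) (at p within {1..})"
    by (simp add: gh_dist_Cyl_tendsto)
  show "gh_diverges TYPE('b) (\<lambda>n. Cyl (real (Suc n)))"
    by (metis Cyl_subsequence_not_gh_converges strict_mono_id comp_id gh_diverges_def)
  have "range (\<lambda>n. Cyl (real (Suc n))) \<subseteq> {Cyl (real n) | n::nat. n \<ge> 1}"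
    by force
  then show "\<not> gh_precompact TYPE('b) {Cyl (real n) | n::nat. n \<ge> 1}"
    unfolding gh_precompact_def using Cyl_subsequence_not_gh_converges by blast
  show "\<exists>\<tau>_lim. \<forall>x\<in>cyl_carrier. \<forall>y\<in>cyl_carrier.
          (\<lambda>n. cyl_tau (real (Suc n)) x y) \<longlonglongrightarrow> \<tau>_lim x y"
    using cyl_tau_pointwise_tendsto
    by (intro exI[of _ "\<lambda>(s, \<alpha>) (t, \<beta>). if arc_dist \<alpha> \<beta> < t - s then t - s else 0"]) auto
qed

end
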